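(* Let $r,s$ be nonzero real numbers with $r+s=1$, let $X$ be a real normed space, and let $Y$ be a real Banach space. Let $d>0$ and $\delta\ge 0$ be given. Assume that an even mapping $f : X\to Y$ satisfies the inequality $$\| f(rx+sy)+rs f(x-y)-r f(x)-s f(y)\|\le \delta$$ for all $x,y\in X$ with $\|x\|+\|y\|\ge d$. Then there exists a unique quadratic mapping $Q : X\to Y$ such that $Q(x)=\lim_{n\to\infty}4^{-n}f(2^n x)$ and $$\| f(x)-Q(x)\|\le \frac{19(2+|r|+|s|)}{2|rs|}\,\delta$$ for all $x\in X$.
   Context: A mapping $Q : X\to Y$ between real vector spaces is called quadratic if $Q(x+y)+Q(x-y)=2Q(x)+2Q(y)$ for all $x,y\in X$. A mapping $f$ is even if $f(-x)=f(x)$ for all $x\in X$.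
   Formalization: The formal statement additionally assumes that X is not the zero space; for X = {0} the inequality is vacuous, so with δ = 0 and f(0) ≠ 0 the claimed bound fails. *)

theory Defs
  imports Complex_Main
begin

definition quadratic_map :: "('a::real_vector \<Rightarrow> 'b::real_vector) \<Rightarrow> bool" where
  "quadratic_map Q \<longleftrightarrow>
     (\<forall>x y. Q (x + y) + Q (x - y) = 2 *\<^sub>R Q x + 2 *\<^sub>R Q y)"

definition even_map :: "('a::real_vector \<Rightarrow> 'b::real_vector) \<Rightarrow> bool" where
  "even_map f \<longleftrightarrow> (\<forall>x. f (- x) = f x)"

end

theory Submission
  imports Defs
begin

text \<open>
  Write \<open>D x y\<close> for the vector \<open>f (r x + s y) + r s f (x - y) - r f x - s f y\<close> whose norm is
  controlled, and \<open>P x y = f (x + y) + f (x - y) - 2 f x - 2 f y\<close> for the defect of \<open>f\<close> from being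
  quadratic. Because \<open>r + s = 1\<close> and \<open>f\<close> is even,
  \<open>- r s P m w = D (m + s w) (m - r w) + r D m (m + w) + s D (m - w) m\<close>.
  In each of the three pairs on the right the entries differ by \<open>\<plusminus> w\<close>, so their norms add up to at
  least \<open>norm w\<close>. Hence \<open>P m w\<close> has norm at most \<open>\<epsilon> = (1 + |r| + |s|) \<delta> / |r s|\<close> as soon as
  \<open>norm w \<ge> d\<close>, with no condition on \<open>m\<close> (lemma \<open>quadratic_defect_bound_far\<close>); by symmetry of \<open>P\<close>
  the same holds if \<open>norm m \<ge> d\<close>.

  The restriction is removed by an auxiliary far vector \<open>z\<close>, through the identity
  \<open>2 P m w = P (m + z) w + P (m - z) w - P (m + w) z - P (m - w) z + 2 P m z\<close>,
  which gives the bound \<open>3 \<epsilon>\<close> for all \<open>m\<close> and \<open>w\<close> (lemma \<open>quadratic_defect_bound_everywhere\<close>).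
  On the diagonal, together with \<open>norm (f 0) \<le> \<delta> / |r s|\<close>, this bounds \<open>f (2 x) - 4 f x\<close>
  uniformly. Hyers' direct method (lemmas \<open>hyers_limit\<close> and \<open>quadratic_map_hyers_limit\<close>) then
  produces \<open>Q\<close>, at distance at most \<open>\<epsilon> + \<delta> / (3 |r s|)\<close> from \<open>f\<close>. This is well below the stated
  bound, so the constant 19 is far from optimal. Uniqueness is that of limits.
\<close>

text \<open>The amount by which \<open>f\<close> fails the quadratic functional equation at \<open>x\<close> and \<open>y\<close>.\<close>

definition quadratic_defect :: "('a::real_vector \<Rightarrow> 'b::real_vector) \<Rightarrow> 'a \<Rightarrow> 'a \<Rightarrow> 'b" where
  "quadratic_defect f x y = f (x + y) + f (x - y) - 2 *\<^sub>R f x - 2 *\<^sub>R f y"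

lemma quadratic_map_iff_defect: "quadratic_map Q \<longleftrightarrow> (\<forall>x y. quadratic_defect Q x y = 0)"
  by (simp add: quadratic_map_def quadratic_defect_def diff_diff_eq)

lemma quadratic_defect_commute:
  assumes "even_map f"
  shows "quadratic_defect f x y = quadratic_defect f y x"
proof -
  have "f (x - y) = f (y - x)"
    using assms by (metis even_map_def minus_diff_eq)
  then show ?thesis
    by (simp add: quadratic_defect_def add.commute)
qed

lemma quadratic_defect_bound_far:
  fixes r s d \<delta> :: real
    and f :: "'a::real_normed_vector \<Rightarrow> 'b::real_normed_vector"
  assumes r: "r \<noteq> 0" and s: "s \<noteq> 0" and rs: "r + s = 1" and ev: "even_map f"
    and D: "\<And>x y. norm x + norm y \<ge> d \<Longrightarrow>
           norm (f (r *\<^sub>R x + s *\<^sub>R y) + (r * s) *\<^sub>R f (x - y) - r *\<^sub>R f x - s *\<^sub>R f y) \<le> \<delta>"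
    and w: "norm w \<ge> d"
  shows "norm (quadratic_defect f m w) \<le> (1 + \<bar>r\<bar> + \<bar>s\<bar>) * \<delta> / \<bar>r * s\<bar>"
proof -
  define D' where "D' x y =
    f (r *\<^sub>R x + s *\<^sub>R y) + (r * s) *\<^sub>R f (x - y) - r *\<^sub>R f x - s *\<^sub>R f y" for x y
  have bound: "norm (D' x y) \<le> \<delta>" if "x - y = w \<or> y - x = w" for x y
  proof -
    have "norm w \<le> norm x + norm y"
      using that norm_triangle_ineq4[of x y] norm_triangle_ineq4[of y x] by auto
    then show ?thesis
      unfolding D'_def using w by (intro D) linarith
  qed
  have s_eq: "s = 1 - r"
    using rs by simp
  have D1: "D' (m + s *\<^sub>R w) (m - r *\<^sub>R w) =
      f m + (r * s) *\<^sub>R f w - r *\<^sub>R f (m + s *\<^sub>R w) - s *\<^sub>R f (m - r *\<^sub>R w)"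
  proof -
    have "r *\<^sub>R (m + s *\<^sub>R w) + s *\<^sub>R (m - r *\<^sub>R w) = m"
         "m + s *\<^sub>R w - (m - r *\<^sub>R w) = w"
      by (simp_all add: s_eq algebra_simps)
    then show ?thesis
      by (simp add: D'_def)
  qed
  have D2: "D' m (m + w) = f (m + s *\<^sub>R w) + (r * s) *\<^sub>R f w - r *\<^sub>R f m - s *\<^sub>R f (m + w)"
  proof -
    have "r *\<^sub>R m + s *\<^sub>R (m + w) = m + s *\<^sub>R w"
      by (simp add: s_eq algebra_simps)
    then show ?thesis
      using ev by (simp add: D'_def even_map_def)
  qed
  have D3: "D' (m - w) m = f (m - r *\<^sub>R w) + (r * s) *\<^sub>R f w - r *\<^sub>R f (m - w) - s *\<^sub>R f m"
  proof -
    have "r *\<^sub>R (m - w) + s *\<^sub>R m = m - r *\<^sub>R w"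
      by (simp add: s_eq algebra_simps)
    then show ?thesis
      using ev by (simp add: D'_def even_map_def)
  qed
  have "(r * s) *\<^sub>R quadratic_defect f m w =
      - (D' (m + s *\<^sub>R w) (m - r *\<^sub>R w) + r *\<^sub>R D' m (m + w) + s *\<^sub>R D' (m - w) m)"
    unfolding D1 D2 D3 quadratic_defect_def
    by (simp add: s_eq algebra_simps scaleR_2)
  then have "\<bar>r * s\<bar> * norm (quadratic_defect f m w) =
      norm (D' (m + s *\<^sub>R w) (m - r *\<^sub>R w) + r *\<^sub>R D' m (m + w) + s *\<^sub>R D' (m - w) m)"
    by (metis norm_minus_cancel norm_scaleR)
  also have "\<dots> \<le> \<delta> + \<bar>r\<bar> * \<delta> + \<bar>s\<bar> * \<delta>"
  proof (intro norm_triangle_mono)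
    show "norm (D' (m + s *\<^sub>R w) (m - r *\<^sub>R w)) \<le> \<delta>"
      by (intro bound) (simp add: s_eq algebra_simps)
    show "norm (r *\<^sub>R D' m (m + w)) \<le> \<bar>r\<bar> * \<delta>"
      using bound[of m "m + w"] by (simp add: mult_left_mono)
    show "norm (s *\<^sub>R D' (m - w) m) \<le> \<bar>s\<bar> * \<delta>"
      using bound[of "m - w" m] by (simp add: mult_left_mono)
  qed
  finally show ?thesis
    using r s by (simp add: field_simps)
qed

lemma exists_norm_ge:
  fixes x0 :: "'a::real_normed_vector"
  assumes "x0 \<noteq> 0"
  shows "\<exists>z::'a. norm z \<ge> c"
proof
  show "norm ((c / norm x0) *\<^sub>R x0) \<ge> c"
    using assms by simp
qed

lemma quadratic_defect_bound_everywhere: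
  fixes f :: "'a::real_normed_vector \<Rightarrow> 'b::real_normed_vector"
  assumes nontrivial: "\<exists>x::'a. x \<noteq> 0" and ev: "even_map f"
    and far: "\<And>m w. norm w \<ge> d \<Longrightarrow> norm (quadratic_defect f m w) \<le> \<epsilon>"
  shows "norm (quadratic_defect f m w) \<le> 3 * \<epsilon>"
proof -
  let ?P = "quadratic_defect f"
  have far': "norm (?P m w) \<le> \<epsilon>" if "norm m \<ge> d" for m w
    using far[OF that] quadratic_defect_commute[OF ev] by metis
  obtain z :: 'a where "norm z \<ge> \<bar>d\<bar> + norm m"
    using nontrivial exists_norm_ge by blast
  then have z: "norm z \<ge> d" "norm (m + z) \<ge> d" "norm (m - z) \<ge> d"
    using norm_triangle_ineq2[of z m] norm_triangle_ineq2[of z "- m"] norm_ge_zero[of m] abs_ge_self[of d]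
    by (auto simp: add.commute norm_minus_commute simp del: norm_ge_zero abs_ge_self)
  have "2 *\<^sub>R ?P m w =
      ?P (m + z) w + ?P (m - z) w + (- ?P (m + w) z) + (- ?P (m - w) z) + 2 *\<^sub>R ?P m z"
    by (simp add: quadratic_defect_def algebra_simps scaleR_2)
  then have "2 * norm (?P m w) =
      norm (?P (m + z) w + ?P (m - z) w + (- ?P (m + w) z) + (- ?P (m - w) z) + 2 *\<^sub>R ?P m z)"
    by (metis norm_scaleR abs_numeral)
  also have "\<dots> \<le> \<epsilon> + \<epsilon> + \<epsilon> + \<epsilon> + 2 * \<epsilon>"
    using far'[OF z(2)] far'[OF z(3)] far[OF z(1)] by (intro norm_triangle_mono) simp_all
  finally show ?thesis
    by simp
qed

text \<open>
  Hyers' direct method: if doubling the argument multiplies \<open>f\<close> by four up to a bounded error,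
  then the increments of \<open>f (2\<^sup>n x) / 4\<^sup>n\<close> are dominated by a geometric series.
\<close>

lemma hyers_limit:
  fixes f :: "'a::real_vector \<Rightarrow> 'b::banach"
  assumes K: "\<And>x. norm (f (2 *\<^sub>R x) - 4 *\<^sub>R f x) \<le> K"
  obtains Q where "\<And>x. (\<lambda>n. (1 / 4 ^ n) *\<^sub>R f ((2 ^ n) *\<^sub>R x)) \<longlonglongrightarrow> Q x"
    and "\<And>x. norm (f x - Q x) \<le> K / 3"
proof -
  define a where "a x n = (1 / 4 ^ n) *\<^sub>R f ((2 ^ n) *\<^sub>R x)" for x n
  have step: "norm (a x (Suc n) - a x n) \<le> K / 4 * (1 / 4) ^ n" for x n
  proof -
    have "a x (Suc n) - a x n =
        (1 / 4 ^ Suc n) *\<^sub>R (f (2 *\<^sub>R (2 ^ n *\<^sub>R x)) - 4 *\<^sub>R f (2 ^ n *\<^sub>R x))"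
      by (simp add: a_def scaleR_diff_right)
    then have "norm (a x (Suc n) - a x n) =
        (1 / 4 ^ Suc n) * norm (f (2 *\<^sub>R (2 ^ n *\<^sub>R x)) - 4 *\<^sub>R f (2 ^ n *\<^sub>R x))"
      by simp
    also have "\<dots> \<le> (1 / 4 ^ Suc n) * K"
      by (intro mult_left_mono K) simp
    finally show ?thesis
      by (simp add: power_one_over)
  qed
  have geom: "(\<lambda>n. K / 4 * (1 / 4) ^ n) sums (K / 3)"
    using sums_mult[OF geometric_sums[of "1 / 4 :: real"], of "K / 4"] by simp
  have "\<exists>l. a x \<longlonglongrightarrow> l \<and> norm (f x - l) \<le> K / 3" for x
  proof (intro exI conjI)
    let ?S = "\<Sum>n. a x (Suc n) - a x n"
    have summable: "summable (\<lambda>n. a x (Suc n) - a x n)"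
      by (rule summable_comparison_test'[OF sums_summable[OF geom] step])
    have a0: "a x 0 = f x"
      by (simp add: a_def)
    have "(\<lambda>N. f x + (\<Sum>n<N. a x (Suc n) - a x n)) \<longlonglongrightarrow> f x + ?S"
      by (intro tendsto_intros summable_LIMSEQ summable)
    then show "a x \<longlonglongrightarrow> f x + ?S"
      by (simp add: sum_lessThan_telescope a0)
    have "norm ?S \<le> (\<Sum>n. K / 4 * (1 / 4) ^ n)"
      by (rule norm_suminf_le[OF step sums_summable[OF geom]])
    then show "norm (f x - (f x + ?S)) \<le> K / 3"
      using sums_unique[OF geom] by simp
  qed
  then obtain Q where "\<And>x. a x \<longlonglongrightarrow> Q x \<and> norm (f x - Q x) \<le> K / 3"
    by metis
  then show thesis
    using that[of Q] unfolding a_def by blast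
qed

lemma quadratic_map_hyers_limit:
  fixes f Q :: "'a::real_vector \<Rightarrow> 'b::real_normed_vector"
  assumes B: "\<And>x y. norm (quadratic_defect f x y) \<le> B"
    and Q: "\<And>x. (\<lambda>n. (1 / 4 ^ n) *\<^sub>R f ((2 ^ n) *\<^sub>R x)) \<longlonglongrightarrow> Q x"
  shows "quadratic_map Q"
  unfolding quadratic_map_iff_defect
proof (intro allI)
  fix x y
  let ?P = "\<lambda>n. (1 / 4 ^ n) *\<^sub>R quadratic_defect f (2 ^ n *\<^sub>R x) (2 ^ n *\<^sub>R y)"
  have "(\<lambda>n. (1 / 4 ^ n) *\<^sub>R f (2 ^ n *\<^sub>R (x + y)) + (1 / 4 ^ n) *\<^sub>R f (2 ^ n *\<^sub>R (x - y))
      - 2 *\<^sub>R ((1 / 4 ^ n) *\<^sub>R f (2 ^ n *\<^sub>R x)) - 2 *\<^sub>R ((1 / 4 ^ n) *\<^sub>R f (2 ^ n *\<^sub>R y)))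
    \<longlonglongrightarrow> quadratic_defect Q x y"
    unfolding quadratic_defect_def by (intro tendsto_intros Q)
  then have lim: "?P \<longlonglongrightarrow> quadratic_defect Q x y"
    by (simp add: quadratic_defect_def algebra_simps)
  have "(\<lambda>n. (1 / 4 :: real) ^ n) \<longlonglongrightarrow> 0"
    by (intro LIMSEQ_realpow_zero) auto
  moreover have "norm (?P n) \<le> norm ((1 / 4 :: real) ^ n) * B" for n
    using B by (simp add: power_one_over divide_right_mono)
  ultimately have "?P \<longlonglongrightarrow> 0"
    by (intro tendsto_0_le[where g = ?P and K = B]) auto
  with lim show "quadratic_defect Q x y = 0"
    by (rule LIMSEQ_unique)
qed

theorem theorem3p4:
  fixes r s d \<delta> :: real
    and f :: "'a::real_normed_vector \<Rightarrow> 'b::banach"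
  assumes nontrivial: "\<exists>x::'a. x \<noteq> 0"
    and "r \<noteq> 0" and "s \<noteq> 0" and "r + s = 1"
    and "d > 0" and "\<delta> \<ge> 0"
    and "even_map f"
    and "\<And>x y. norm x + norm y \<ge> d \<Longrightarrow>
           norm (f (r *\<^sub>R x + s *\<^sub>R y) + (r * s) *\<^sub>R f (x - y) - r *\<^sub>R f x - s *\<^sub>R f y) \<le> \<delta>"
  shows "\<exists>!Q :: 'a \<Rightarrow> 'b. quadratic_map Q
           \<and> (\<forall>x. (\<lambda>n. (1 / 4 ^ n) *\<^sub>R f ((2 ^ n) *\<^sub>R x)) \<longlonglongrightarrow> Q x)
           \<and> (\<forall>x. norm (f x - Q x) \<le> 19 * (2 + \<bar>r\<bar> + \<bar>s\<bar>) / (2 * \<bar>r * s\<bar>) * \<delta>)"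
proof -
  define \<epsilon> where "\<epsilon> = (1 + \<bar>r\<bar> + \<bar>s\<bar>) * \<delta> / \<bar>r * s\<bar>"
  define K where "K = 3 * \<epsilon> + \<delta> / \<bar>r * s\<bar>"
  note D = assms(8)
  have far: "norm (quadratic_defect f m w) \<le> \<epsilon>" if "norm w \<ge> d" for m w
    unfolding \<epsilon>_def using quadratic_defect_bound_far[OF assms(2-4,7) D that] by simp
  have near: "norm (quadratic_defect f m w) \<le> 3 * \<epsilon>" for m w
    using quadratic_defect_bound_everywhere[OF nontrivial assms(7) far] by simp
  \<comment> \<open>Taking \<open>x = y\<close> in the hypothesis leaves only the term \<open>r s f 0\<close>.\<close>
  have f0: "norm (f 0) \<le> \<delta> / \<bar>r * s\<bar>"
  proof -
    obtain z :: 'a where "norm z \<ge> d"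
      using nontrivial exists_norm_ge by blast
    then have "norm z + norm z \<ge> d"
      using norm_ge_zero[of z] by linarith
    then have "norm (f (r *\<^sub>R z + s *\<^sub>R z) + (r * s) *\<^sub>R f (z - z) - r *\<^sub>R f z - s *\<^sub>R f z) \<le> \<delta>"
      by (rule D)
    moreover have "f (r *\<^sub>R z + s *\<^sub>R z) + (r * s) *\<^sub>R f (z - z) - r *\<^sub>R f z - s *\<^sub>R f z
        = (r * s) *\<^sub>R f 0"
    proof -
      have s_eq: "s = 1 - r"
        using \<open>r + s = 1\<close> by simp
      show ?thesis
        by (simp add: s_eq algebra_simps)
    qed
    ultimately have "norm ((r * s) *\<^sub>R f 0) \<le> \<delta>"
      by (simp only:)
    then show ?thesis
      using assms(2,3) by (simp add: field_simps abs_mult)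
  qed
  have K: "norm (f (2 *\<^sub>R x) - 4 *\<^sub>R f x) \<le> K" for x
  proof -
    have "f (2 *\<^sub>R x) - 4 *\<^sub>R f x = quadratic_defect f x x - f 0"
    proof -
      have "(4::real) *\<^sub>R f x = 2 *\<^sub>R f x + 2 *\<^sub>R f x"
        by (simp flip: scaleR_left_distrib)
      then show ?thesis
        by (simp add: quadratic_defect_def scaleR_2)
    qed
    then show ?thesis
      unfolding K_def using near[of x x] f0 norm_triangle_ineq4[of "quadratic_defect f x x" "f 0"]
      by simp
  qed
  obtain Q where lim: "\<And>x. (\<lambda>n. (1 / 4 ^ n) *\<^sub>R f ((2 ^ n) *\<^sub>R x)) \<longlonglongrightarrow> Q x"
    and dist: "\<And>x. norm (f x - Q x) \<le> K / 3"
    using hyers_limit[of f K, OF K] by blast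
  have const: "K / 3 \<le> 19 * (2 + \<bar>r\<bar> + \<bar>s\<bar>) / (2 * \<bar>r * s\<bar>) * \<delta>"
  proof -
    define q where "q = \<delta> / \<bar>r * s\<bar>"
    have "q \<ge> 0"
      using \<open>\<delta> \<ge> 0\<close> by (simp add: q_def)
    then have "(1 + \<bar>r\<bar> + \<bar>s\<bar> + 1 / 3) * q \<le> 19 / 2 * (2 + \<bar>r\<bar> + \<bar>s\<bar>) * q"
      by (intro mult_right_mono) auto
    moreover have "K / 3 = (1 + \<bar>r\<bar> + \<bar>s\<bar> + 1 / 3) * q"
    proof -
      have "\<epsilon> = (1 + \<bar>r\<bar> + \<bar>s\<bar>) * q" "K = 3 * \<epsilon> + q"
        by (simp_all add: K_def \<epsilon>_def q_def)
      then show ?thesis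
        by (simp add: algebra_simps)
    qed
    moreover have "19 * (2 + \<bar>r\<bar> + \<bar>s\<bar>) / (2 * \<bar>r * s\<bar>) * \<delta> = 19 / 2 * (2 + \<bar>r\<bar> + \<bar>s\<bar>) * q"
      by (simp add: q_def)
    ultimately show ?thesis
      by (simp only:)
  qed
  show ?thesis
  proof (intro ex1I[of _ Q] conjI allI)
    show "quadratic_map Q"
      using near lim by (rule quadratic_map_hyers_limit)
    show "(\<lambda>n. (1 / 4 ^ n) *\<^sub>R f ((2 ^ n) *\<^sub>R x)) \<longlonglongrightarrow> Q x" for x
      by (rule lim)
    show "norm (f x - Q x) \<le> 19 * (2 + \<bar>r\<bar> + \<bar>s\<bar>) / (2 * \<bar>r * s\<bar>) * \<delta>" for x
      using dist const by (rule order_trans)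
  next
    fix Q'
    assume "quadratic_map Q'
      \<and> (\<forall>x. (\<lambda>n. (1 / 4 ^ n) *\<^sub>R f ((2 ^ n) *\<^sub>R x)) \<longlonglongrightarrow> Q' x)
      \<and> (\<forall>x. norm (f x - Q' x) \<le> 19 * (2 + \<bar>r\<bar> + \<bar>s\<bar>) / (2 * \<bar>r * s\<bar>) * \<delta>)"
    then show "Q' = Q"
      using lim LIMSEQ_unique by blast
  qed
qed

end
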